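(* Let $(A,\alpha)$ be an injective unital C*-dynamical system of multiplicity $d$. Then $\mathcal{O}(A,\alpha)$ has no $(\sigma,\beta)$-KMS states for $\beta\neq\log d$.
   Context: A unital C*-dynamical system $(A,\alpha)$ of multiplicity $d$ (with $1 \le d < \infty$) consists of a unital C*-algebra $A$ and $d$ unital $*$-endomorphisms $\alpha_1,\dots,\alpha_d$ of $A$. It is injective if $\bigcap_{i=1}^d\ker\alpha_i=(0)$. For an injective unital system, $\mathcal{O}(A,\alpha)$ (the Cuntz-Pimsner algebra) is the universal C*-algebra generated by $A$ and elements $S_1,\dots,S_d$ such that $[S_1,\dots,S_d]$ is a row unitary ($S_i^*S_j=\delta_{i,j}1$ and $\sum_{i=1}^dS_iS_i^*=1$) and $aS_i=S_i\alpha_i(a)$ for all $a\in A$, $i=1,\dots,d$. The algebra $A$ embeds in it isometrically and the unit of $A$ is its unit. The gauge action satisfies $\gamma_z(a)=a$, $\gamma_z(S_i)=zS_i$ for $z\in\mathbb{T}$, and $\sigma:\mathbb{R}\to\mathrm{Aut}(\mathcal{O}(A,\alpha))$ is $\sigma_t=\gamma_{e^{it}}$. For $\beta\in\mathbb{R}$, a state $\psi$ on a C*-algebra $B$ with an action $\sigma$ of $\mathbb{R}$ is a $(\sigma,\beta)$-KMS state if $\psi(xy)=\psi(y\sigma_{i\beta}(x))$ for all $x,y$ in a norm-dense $\sigma$-invariant $*$-subalgebra of the analytic elements of $B$ (elements $x$ for which $t\mapsto\sigma_t(x)$ extends to an entire function $z\mapsto\sigma_z(x)$). *)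

theory Defs
  imports
    "HOL-Analysis.Analysis"
    "HOL-Algebra.Module"
    "HOL-Algebra.AbelCoset"
begin

definition complex_ring :: "complex ring" where
  "complex_ring =
    \<lparr>carrier = UNIV, mult = (*), one = 1, zero = 0, add = (+)\<rparr>"

lemma complex_ring_simps [simp]:
  "carrier complex_ring = UNIV"
  "x \<otimes>\<^bsub>complex_ring\<^esub> y = x * y"
  "\<one>\<^bsub>complex_ring\<^esub> = 1"
  "\<zero>\<^bsub>complex_ring\<^esub> = 0"
  "x \<oplus>\<^bsub>complex_ring\<^esub> y = x + y"
  by (simp_all add: complex_ring_def)


section \<open>Unital C*-algebras\<close>

text \<open>
  C*-algebras are records with an explicit carrier, so that one can quantify over
  all C*-algebra structures with a given underlying type (see the universal
  property below).
\<close>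

record 'a cstar = "(complex, 'a) module" +
  adj :: "'a \<Rightarrow> 'a"
  cnorm :: "'a \<Rightarrow> real"

text \<open>
  The value outside the carrier is irrelevant; it is set to 0 because the locale
  \<^locale>\<open>Metric_space\<close> asks for non-negativity and symmetry on the whole type.
\<close>

definition cdist :: "'a cstar \<Rightarrow> 'a \<Rightarrow> 'a \<Rightarrow> real" where
  "cdist B x y =
    (if x \<in> carrier B \<and> y \<in> carrier B then cnorm B (x \<ominus>\<^bsub>B\<^esub> y) else 0)"

abbreviation norm_topology :: "'a cstar \<Rightarrow> 'a topology" where
  "norm_topology B \<equiv> Metric_space.mtopology (carrier B) (cdist B)"

text \<open>
  The zero algebra is not excluded; it has no states.
\<close>

locale unital_cstar_algebra =
  M?: ring B + Module.module complex_ring B for B :: "'a cstar" (structure) +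
  assumes smult_mult_left:
      "\<lbrakk>x \<in> carrier B; y \<in> carrier B\<rbrakk> \<Longrightarrow> (c \<odot> x) \<otimes> y = c \<odot> (x \<otimes> y)"
    and smult_mult_right:
      "\<lbrakk>x \<in> carrier B; y \<in> carrier B\<rbrakk> \<Longrightarrow> x \<otimes> (c \<odot> y) = c \<odot> (x \<otimes> y)"
    and adj_closed: "x \<in> carrier B \<Longrightarrow> adj B x \<in> carrier B"
    and adj_adj: "x \<in> carrier B \<Longrightarrow> adj B (adj B x) = x"
    and adj_add:
      "\<lbrakk>x \<in> carrier B; y \<in> carrier B\<rbrakk> \<Longrightarrow> adj B (x \<oplus> y) = adj B x \<oplus> adj B y"
    and adj_smult: "x \<in> carrier B \<Longrightarrow> adj B (c \<odot> x) = cnj c \<odot> adj B x"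
    and adj_mult:
      "\<lbrakk>x \<in> carrier B; y \<in> carrier B\<rbrakk> \<Longrightarrow> adj B (x \<otimes> y) = adj B y \<otimes> adj B x"
    and cnorm_nonneg: "x \<in> carrier B \<Longrightarrow> 0 \<le> cnorm B x"
    and cnorm_eq_0: "x \<in> carrier B \<Longrightarrow> cnorm B x = 0 \<longleftrightarrow> x = \<zero>"
    and cnorm_triangle:
      "\<lbrakk>x \<in> carrier B; y \<in> carrier B\<rbrakk> \<Longrightarrow> cnorm B (x \<oplus> y) \<le> cnorm B x + cnorm B y"
    and cnorm_smult: "x \<in> carrier B \<Longrightarrow> cnorm B (c \<odot> x) = cmod c * cnorm B x"
    and cnorm_mult:
      "\<lbrakk>x \<in> carrier B; y \<in> carrier B\<rbrakk> \<Longrightarrow> cnorm B (x \<otimes> y) \<le> cnorm B x * cnorm B y"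
    and cstar_identity: "x \<in> carrier B \<Longrightarrow> cnorm B (adj B x \<otimes> x) = (cnorm B x)\<^sup>2"
    and complete: "Metric_space.mcomplete (carrier B) (cdist B)"
begin

lemma Metric_space_cdist: "Metric_space (carrier B) (cdist B)"
proof
  fix x y z
  have neg: "cnorm B (\<ominus> u) = cnorm B u" if "u \<in> carrier B" for u
  proof -
    have "(-1) \<odot> u \<oplus> u = (-1) \<odot> u \<oplus> 1 \<odot> u"
      using smult_one[of u] that by simp
    also have "\<dots> = 0 \<odot> u"
      using smult_l_distr[of "-1" 1 u] that by simp
    also have "\<dots> = \<zero>"
    proof -
      have "0 \<odot> u \<in> carrier B"
        using that smult_closed[of 0 u] by simp
      moreover have "cnorm B (0 \<odot> u) = 0"
        using that cnorm_smult[of u 0] by simp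
      ultimately show ?thesis
        using cnorm_eq_0 by blast
    qed
    finally have "\<ominus> u = (-1) \<odot> u"
      using that smult_closed[of "-1" u] M.minus_equality[of "(-1) \<odot> u" u] by simp
    then show ?thesis
      using that cnorm_smult[of u "-1"] by simp
  qed
  show "0 \<le> cdist B x y"
    by (simp add: cdist_def cnorm_nonneg)
  show "cdist B x y = cdist B y x"
  proof (cases "x \<in> carrier B \<and> y \<in> carrier B")
    case True
    then have "\<ominus> (x \<ominus> y) = y \<ominus> x"
      by (simp add: M.minus_eq M.minus_add M.a_comm)
    then show ?thesis
      using True neg[of "x \<ominus> y"] by (simp add: cdist_def)
  qed (auto simp: cdist_def)
  show "cdist B x y = 0 \<longleftrightarrow> x = y" if "x \<in> carrier B" "y \<in> carrier B"
  proof -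
    have "x = y" if "x \<ominus> y = \<zero>"
      using that \<open>x \<in> carrier B\<close> \<open>y \<in> carrier B\<close>
        M.minus_equality[of x "\<ominus> y"] by (simp add: M.minus_eq)
    moreover have "y \<ominus> y = \<zero>"
      using that by (simp add: M.minus_eq M.r_neg)
    ultimately show ?thesis
      using that cnorm_eq_0[of "x \<ominus> y"] by (auto simp: cdist_def)
  qed
  show "cdist B x z \<le> cdist B x y + cdist B y z"
    if "x \<in> carrier B" "y \<in> carrier B" "z \<in> carrier B"
  proof -
    have "(x \<ominus> y) \<oplus> (y \<ominus> z) = x \<ominus> z"
      using that by (simp add: M.minus_eq M.a_assoc M.r_neg1)
    then show ?thesis
      using that cnorm_triangle[of "x \<ominus> y" "y \<ominus> z"] by (simp add: cdist_def)
  qed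
qed

end

definition unital_star_hom :: "'a cstar \<Rightarrow> 'b cstar \<Rightarrow> ('a \<Rightarrow> 'b) \<Rightarrow> bool" where
  "unital_star_hom A B h \<longleftrightarrow>
     h \<in> ring_hom A B \<and>
     (\<forall>c. \<forall>x\<in>carrier A. h (c \<odot>\<^bsub>A\<^esub> x) = c \<odot>\<^bsub>B\<^esub> h x) \<and>
     (\<forall>x\<in>carrier A. h (adj A x) = adj B (h x))"

definition star_automorphism :: "'a cstar \<Rightarrow> ('a \<Rightarrow> 'a) \<Rightarrow> bool" where
  "star_automorphism B h \<longleftrightarrow>
     unital_star_hom B B h \<and> bij_betw h (carrier B) (carrier B)"

text \<open>
  A *-subalgebra need not contain the unit.
\<close>

definition star_subalgebra :: "'a cstar \<Rightarrow> 'a set \<Rightarrow> bool" where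
  "star_subalgebra B X \<longleftrightarrow>
     submodule X complex_ring B \<and>
     (\<forall>x\<in>X. \<forall>y\<in>X. x \<otimes>\<^bsub>B\<^esub> y \<in> X) \<and>
     (\<forall>x\<in>X. adj B x \<in> X)"

definition cstar_generated_by :: "'a cstar \<Rightarrow> 'a set \<Rightarrow> bool" where
  "cstar_generated_by B G \<longleftrightarrow>
     (\<lambda>X. star_subalgebra B X \<and> closedin (norm_topology B) X) hull G = carrier B"


section \<open>C*-dynamical systems and Cuntz-Pimsner algebras\<close>

locale unital_cstar_system = unital_cstar_algebra A
  for A :: "'a cstar" (structure) +
  fixes d :: nat and \<alpha> :: "nat \<Rightarrow> 'a \<Rightarrow> 'a"
  assumes multiplicity: "1 \<le> d"
    and endomorphism: "i \<in> {1..d} \<Longrightarrow> unital_star_hom A A (\<alpha> i)"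

locale injective_unital_cstar_system = unital_cstar_system +
  assumes injective: "(\<Inter>i\<in>{1..d}. a_kernel A A (\<alpha> i)) = {\<zero>}"

definition row_unitary :: "'b cstar \<Rightarrow> nat \<Rightarrow> (nat \<Rightarrow> 'b) \<Rightarrow> bool" where
  "row_unitary B d S \<longleftrightarrow>
     (\<forall>i\<in>{1..d}. S i \<in> carrier B) \<and>
     (\<forall>i\<in>{1..d}. \<forall>j\<in>{1..d}.
        adj B (S i) \<otimes>\<^bsub>B\<^esub> S j = (if i = j then \<one>\<^bsub>B\<^esub> else \<zero>\<^bsub>B\<^esub>)) \<and>
     (\<Oplus>\<^bsub>B\<^esub>i\<in>{1..d}. S i \<otimes>\<^bsub>B\<^esub> adj B (S i)) = \<one>\<^bsub>B\<^esub>"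

definition covariant_row_unitary ::
  "'a cstar \<Rightarrow> nat \<Rightarrow> (nat \<Rightarrow> 'a \<Rightarrow> 'a) \<Rightarrow> 'b cstar \<Rightarrow> ('a \<Rightarrow> 'b) \<Rightarrow> (nat \<Rightarrow> 'b) \<Rightarrow> bool"
where
  "covariant_row_unitary A d \<alpha> B \<iota> S \<longleftrightarrow>
     unital_star_hom A B \<iota> \<and>
     row_unitary B d S \<and>
     (\<forall>i\<in>{1..d}. \<forall>a\<in>carrier A. \<iota> a \<otimes>\<^bsub>B\<^esub> S i = S i \<otimes>\<^bsub>B\<^esub> \<iota> (\<alpha> i a))"

text \<open>
  \<open>(B, \<iota>, S)\<close> is a universal C*-algebra generated by a copy of \<open>A\<close> and a row
  unitary \<open>S\<close> satisfying the covariance relations; it is unique up to isomorphism.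
  The morphism \<open>\<rho>\<close> in the universal property is unique on the carrier because \<open>B\<close>
  is generated by \<open>\<iota>\<close> and \<open>S\<close>.

  The test algebras \<open>D\<close> range over all C*-algebras with elements of type
  \<^typ>\<open>nat \<Rightarrow> 'a\<close>. This is no restriction: the C*-subalgebra generated by a covariant
  pair has a dense subset of cardinality at most that of \<open>A\<close> (if \<open>A\<close> is nonzero),
  so it has at most as many elements as there are sequences in \<open>A\<close>, and
  hence an isomorphic copy with elements of type \<^typ>\<open>nat \<Rightarrow> 'a\<close>.
\<close>

locale cuntz_pimsner_algebra =
  A: unital_cstar_system A d \<alpha> + B: unital_cstar_algebra B
  for A :: "'a cstar" and d :: nat and \<alpha> :: "nat \<Rightarrow> 'a \<Rightarrow> 'a"
    and B :: "'b cstar" +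
  fixes \<iota> :: "'a \<Rightarrow> 'b" and S :: "nat \<Rightarrow> 'b"
  assumes covariant: "covariant_row_unitary A d \<alpha> B \<iota> S"
    and generated: "cstar_generated_by B (\<iota> ` carrier A \<union> S ` {1..d})"
    and universal:
      "\<And>(D :: (nat \<Rightarrow> 'a) cstar) \<pi> T.
         \<lbrakk>unital_cstar_algebra D; covariant_row_unitary A d \<alpha> D \<pi> T\<rbrakk> \<Longrightarrow>
         \<exists>\<rho>. unital_star_hom B D \<rho> \<and>
             (\<forall>a\<in>carrier A. \<rho> (\<iota> a) = \<pi> a) \<and>
             (\<forall>i\<in>{1..d}. \<rho> (S i) = T i)"

text \<open>
  The formulas on the generators determine \<open>\<gamma> z\<close> on the carrier of \<open>B\<close> for each \<open>z\<close>
  on the unit circle; multiplicativity in \<open>z\<close> and pointwise norm continuity follow.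
\<close>

definition gauge_action ::
  "'a cstar \<Rightarrow> nat \<Rightarrow> 'b cstar \<Rightarrow> ('a \<Rightarrow> 'b) \<Rightarrow> (nat \<Rightarrow> 'b) \<Rightarrow> (complex \<Rightarrow> 'b \<Rightarrow> 'b) \<Rightarrow> bool"
where
  "gauge_action A d B \<iota> S \<gamma> \<longleftrightarrow>
     (\<forall>z. cmod z = 1 \<longrightarrow>
        star_automorphism B (\<gamma> z) \<and>
        (\<forall>a\<in>carrier A. \<gamma> z (\<iota> a) = \<iota> a) \<and>
        (\<forall>i\<in>{1..d}. \<gamma> z (S i) = z \<odot>\<^bsub>B\<^esub> S i))"


section \<open>KMS states\<close>

definition positive_functional :: "'b cstar \<Rightarrow> ('b \<Rightarrow> complex) \<Rightarrow> bool" where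
  "positive_functional B \<psi> \<longleftrightarrow>
     (\<forall>x\<in>carrier B. \<forall>y\<in>carrier B. \<psi> (x \<oplus>\<^bsub>B\<^esub> y) = \<psi> x + \<psi> y) \<and>
     (\<forall>c. \<forall>x\<in>carrier B. \<psi> (c \<odot>\<^bsub>B\<^esub> x) = c * \<psi> x) \<and>
     (\<forall>x\<in>carrier B. \<psi> (adj B x \<otimes>\<^bsub>B\<^esub> x) \<in> \<real>\<^sub>\<ge>\<^sub>0)"

definition state :: "'b cstar \<Rightarrow> ('b \<Rightarrow> complex) \<Rightarrow> bool" where
  "state B \<psi> \<longleftrightarrow>
     positive_functional B \<psi> \<and>
     bdd_above {cmod (\<psi> x) |x. x \<in> carrier B \<and> cnorm B x \<le> 1} \<and>
     Sup {cmod (\<psi> x) |x. x \<in> carrier B \<and> cnorm B x \<le> 1} = 1"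

definition entire :: "'b cstar \<Rightarrow> (complex \<Rightarrow> 'b) \<Rightarrow> bool" where
  "entire B f \<longleftrightarrow>
     range f \<subseteq> carrier B \<and>
     (\<forall>z. \<exists>l\<in>carrier B.
        ((\<lambda>h. cnorm B ((1 / h) \<odot>\<^bsub>B\<^esub> (f (z + h) \<ominus>\<^bsub>B\<^esub> f z) \<ominus>\<^bsub>B\<^esub> l)) \<longlongrightarrow> 0) (at 0))"

definition entire_extension ::
  "'b cstar \<Rightarrow> (real \<Rightarrow> 'b \<Rightarrow> 'b) \<Rightarrow> 'b \<Rightarrow> (complex \<Rightarrow> 'b) \<Rightarrow> bool"
where
  "entire_extension B \<sigma> x f \<longleftrightarrow> entire B f \<and> (\<forall>t. f (complex_of_real t) = \<sigma> t x)"

definition analytic_elements :: "'b cstar \<Rightarrow> (real \<Rightarrow> 'b \<Rightarrow> 'b) \<Rightarrow> 'b set" where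
  "analytic_elements B \<sigma> = {x \<in> carrier B. \<exists>f. entire_extension B \<sigma> x f}"

text \<open>
  \<open>complex_flow B \<sigma> z x\<close> is \<open>\<sigma>\<^sub>z(x)\<close>, for analytic \<open>x\<close>. The entire extension is unique
  by the identity theorem, so the choice is immaterial.
\<close>

definition complex_flow ::
  "'b cstar \<Rightarrow> (real \<Rightarrow> 'b \<Rightarrow> 'b) \<Rightarrow> complex \<Rightarrow> 'b \<Rightarrow> 'b"
where
  "complex_flow B \<sigma> z x = (SOME f. entire_extension B \<sigma> x f) z"

definition kms_state ::
  "'b cstar \<Rightarrow> (real \<Rightarrow> 'b \<Rightarrow> 'b) \<Rightarrow> real \<Rightarrow> ('b \<Rightarrow> complex) \<Rightarrow> bool"
where
  "kms_state B \<sigma> \<beta> \<psi> \<longleftrightarrow>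
     state B \<psi> \<and>
     (\<exists>X. star_subalgebra B X \<and>
          X \<subseteq> analytic_elements B \<sigma> \<and>
          (\<forall>t. \<forall>x\<in>X. \<sigma> t x \<in> X) \<and>
          norm_topology B closure_of X = carrier B \<and>
          (\<forall>x\<in>X. \<forall>y\<in>X.
             \<psi> (x \<otimes>\<^bsub>B\<^esub> y) = \<psi> (y \<otimes>\<^bsub>B\<^esub> complex_flow B \<sigma> (\<i> * complex_of_real \<beta>) x)))"

end

theory Submission
  imports Defs "HOL-Complex_Analysis.Conformal_Mappings" "HOL-Algebra.RingHom"
begin

text \<open>
  The isometries \<open>S\<^sub>i\<close> satisfy \<open>\<sigma>\<^sub>t(S\<^sub>i) = e\<^sup>i\<^sup>t S\<^sub>i\<close>, so the KMS condition should give
  \<open>\<psi>(S\<^sub>i S\<^sub>i*) = e\<^bsup>-\<beta>\<^esup> \<psi>(S\<^sub>i* S\<^sub>i) = e\<^bsup>-\<beta>\<^esup> \<psi>(1)\<close>; summing over \<open>i\<close> yields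
  \<open>\<psi>(1) = d e\<^bsup>-\<beta>\<^esup> \<psi>(1)\<close> with \<open>\<psi>(1) \<noteq> 0\<close>, that is \<open>\<beta> = log d\<close>.

  The KMS condition is only known on some dense invariant *-subalgebra \<open>X\<close>, which need not
  contain the \<open>S\<^sub>i\<close>. For \<open>x, y \<in> X\<close> the entire function \<open>z \<mapsto> \<psi>(y \<sigma>\<^sub>z(x))\<close> has period \<open>2\<pi>\<close>, so
  shifting it by \<open>i\<beta>\<close> multiplies its first Fourier coefficient by \<open>e\<^bsup>-\<beta>\<^esup>\<close>. This relates the first
  Fourier coefficients of \<open>t \<mapsto> \<psi>(\<sigma>\<^sub>t(x) y)\<close> and \<open>t \<mapsto> \<psi>(y \<sigma>\<^sub>t(x))\<close>, and letting \<open>x \<rightarrow> S\<^sub>i\<close> and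
  \<open>y \<rightarrow> S\<^sub>i*\<close> in norm gives the claim, since each \<open>\<sigma>\<^sub>t\<close> is contractive.
\<close>

section \<open>Banach's fixed point theorem\<close>

text \<open>The iterates of \<open>f\<close> from any starting point are Cauchy by comparison with a
  geometric series. The result solves the quadratic equation behind
  \<open>sqrt_one_minus_square\<close>.\<close>

lemma (in Metric_space) contraction_has_fixpoint:
  assumes "mcomplete" "M \<noteq> {}" and f: "\<And>x. x \<in> M \<Longrightarrow> f x \<in> M" and "0 \<le> k" "k < 1"
    and contr: "\<And>x y. x \<in> M \<Longrightarrow> y \<in> M \<Longrightarrow> d (f x) (f y) \<le> k * d x y"
  shows "\<exists>x\<in>M. f x = x"
proof -
  obtain x0 where x0: "x0 \<in> M" using \<open>M \<noteq> {}\<close> by blast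
  define s where "s n = (f ^^ n) x0" for n
  have sM: "s n \<in> M" for n
    by (induction n) (auto simp: s_def x0 f)
  have s_Suc: "s (Suc n) = f (s n)" for n
    by (simp add: s_def)
  define c where "c = d (s 0) (s 1)"
  have step: "d (s n) (s (Suc n)) \<le> k ^ n * c" for n
  proof (induction n)
    case (Suc n)
    have "d (s (Suc n)) (s (Suc (Suc n))) \<le> k * d (s n) (s (Suc n))"
      using contr[OF sM sM, of n "Suc n"] by (simp add: s_Suc)
    also have "\<dots> \<le> k * (k ^ n * c)"
      using Suc \<open>0 \<le> k\<close> by (rule mult_left_mono)
    finally show ?case by (simp add: mult.assoc)
  qed (simp add: c_def)
  have "c \<ge> 0" by (simp add: c_def)
  \<comment> \<open>This is the exact partial sum of the geometric series; keeping the factor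
    \<open>1 - k ^ m\<close> lets the induction close.\<close>
  have tail: "d (s n) (s (n + m)) \<le> k ^ n * c / (1 - k) * (1 - k ^ m)" for n m
  proof (induction m)
    case (Suc m)
    have "d (s n) (s (n + Suc m)) \<le> d (s n) (s (n + m)) + d (s (n + m)) (s (Suc (n + m)))"
      using triangle[OF sM[of n] sM[of "n + m"] sM[of "Suc (n + m)"]] by simp
    also have "\<dots> \<le> k ^ n * c / (1 - k) * (1 - k ^ m) + k ^ (n + m) * c"
      using Suc step by (rule add_mono)
    also have "\<dots> = k ^ n * c / (1 - k) * (1 - k ^ Suc m)"
      using \<open>k < 1\<close> by (simp add: field_simps power_add)
    finally show ?case .
  qed (simp add: sM)
  have bound: "d (s n) (s (n + m)) \<le> k ^ n * (c / (1 - k))" for n m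
  proof -
    have "k ^ n * c / (1 - k) * (1 - k ^ m) \<le> k ^ n * c / (1 - k) * 1"
      using \<open>0 \<le> k\<close> \<open>k < 1\<close> \<open>c \<ge> 0\<close> by (intro mult_left_mono) auto
    with tail[of n m] show ?thesis by simp
  qed
  have "MCauchy s"
    unfolding MCauchy_def
  proof (intro conjI allI impI)
    show "range s \<subseteq> M" using sM by blast
    fix e :: real assume "e > 0"
    have "(\<lambda>n. k ^ n * (c / (1 - k))) \<longlonglongrightarrow> 0 * (c / (1 - k))"
      using \<open>0 \<le> k\<close> \<open>k < 1\<close> by (intro tendsto_intros LIMSEQ_power_zero) auto
    then have "\<forall>\<^sub>F n in sequentially. k ^ n * (c / (1 - k)) < e"
      using \<open>e > 0\<close> by (simp add: order_tendsto_iff)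
    then obtain N where N: "\<And>n. n \<ge> N \<Longrightarrow> k ^ n * (c / (1 - k)) < e"
      by (auto simp: eventually_sequentially)
    have *: "d (s n) (s n') < e" if "N \<le> n" "n \<le> n'" for n n'
      using bound[of n "n' - n"] N[of n] that by simp
    show "\<exists>N. \<forall>n n'. N \<le> n \<longrightarrow> N \<le> n' \<longrightarrow> d (s n) (s n') < e"
      using * commute by (metis nat_le_linear)
  qed
  then obtain x where lim: "limitin mtopology s x sequentially"
    using \<open>mcomplete\<close> by (auto simp: mcomplete_def)
  then have x: "x \<in> M" and dlim: "((\<lambda>n. d (s n) x) \<longlongrightarrow> 0) sequentially"
    by (auto simp: limitin_metric_dist_null)
  \<comment> \<open>Passing from \<open>f x\<close> to \<open>x\<close> through
    \<open>s (Suc n)\<close> gives a bound that tends to 0.\<close>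
  have "((\<lambda>n. d (s (Suc n)) x + k * d (s n) x) \<longlongrightarrow> 0 + k * 0) sequentially"
    using dlim by (intro tendsto_intros LIMSEQ_Suc)
  moreover have "d (f x) x \<le> d (s (Suc n)) x + k * d (s n) x" for n
    using triangle[of "f x" "s (Suc n)" x] contr[OF x sM, of n] x f sM
    by (simp add: s_Suc commute)
  ultimately have "d (f x) x \<le> 0"
    by (metis (no_types, lifting) LIMSEQ_le_const add_0 mult_zero_right)
  with x f show ?thesis
    by (metis nonneg order_antisym zero)
qed

section \<open>Norm, adjoint and square roots in a unital C*-algebra\<close>

context unital_cstar_algebra
begin

interpretation Met: Metric_space "carrier B" "cdist B"
  by (rule Metric_space_cdist)

lemma smult_minus_one: "x \<in> carrier B \<Longrightarrow> (-1) \<odot> x = \<ominus> x"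
  using smult_l_distr[of "-1" 1 x] smult_l_null[of x] smult_one[of x] smult_closed[of "-1" x]
    M.minus_equality[of "(-1) \<odot> x" x]
  by simp

lemma smult_in_carrier [simp, intro]: "x \<in> carrier B \<Longrightarrow> c \<odot> x \<in> carrier B"
  using smult_closed[of c x] by simp

lemma smult_smult: "x \<in> carrier B \<Longrightarrow> c \<odot> (e \<odot> x) = (c * e) \<odot> x"
  using smult_assoc1[of c e x] by simp

lemma smult_one_left [simp]: "x \<in> carrier B \<Longrightarrow> 1 \<odot> x = x"
  using smult_one[of x] by simp

lemma smult_add_left: "x \<in> carrier B \<Longrightarrow> (c + e) \<odot> x = c \<odot> x \<oplus> e \<odot> x"
  using smult_l_distr[of c e x] by simp

lemma smult_add_right: "x \<in> carrier B \<Longrightarrow> y \<in> carrier B \<Longrightarrow> c \<odot> (x \<oplus> y) = c \<odot> x \<oplus> c \<odot> y"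
  using smult_r_distr[of c x y] by simp

lemma smult_minus_right: "x \<in> carrier B \<Longrightarrow> c \<odot> (\<ominus> x) = \<ominus> (c \<odot> x)"
  using smult_r_minus[of c x] by simp

lemma smult_diff_right:
  "x \<in> carrier B \<Longrightarrow> y \<in> carrier B \<Longrightarrow> c \<odot> (x \<ominus> y) = c \<odot> x \<ominus> c \<odot> y"
  by (simp add: M.minus_eq smult_add_right smult_minus_right)

lemma cnorm_minus [simp]: "x \<in> carrier B \<Longrightarrow> cnorm B (\<ominus> x) = cnorm B x"
  using cnorm_smult[of x "-1"] by (simp add: smult_minus_one)

lemma cnorm_zero [simp]: "cnorm B \<zero> = 0"
  using cnorm_eq_0 by blast

lemma cnorm_diff: "x \<in> carrier B \<Longrightarrow> y \<in> carrier B \<Longrightarrow> cnorm B (x \<ominus> y) \<le> cnorm B x + cnorm B y"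
  using cnorm_triangle[of x "\<ominus> y"] by (simp add: M.minus_eq)

lemma adj_minus: "x \<in> carrier B \<Longrightarrow> adj B (\<ominus> x) = \<ominus> adj B x"
  using adj_smult[of x "-1"] by (simp add: smult_minus_one adj_closed)

lemma adj_diff: "x \<in> carrier B \<Longrightarrow> y \<in> carrier B \<Longrightarrow> adj B (x \<ominus> y) = adj B x \<ominus> adj B y"
  by (simp add: M.minus_eq adj_add adj_minus)

lemma adj_one [simp]: "adj B \<one> = \<one>"
  by (metis M.l_one M.one_closed M.r_one adj_adj adj_closed adj_mult)

text \<open>The C*-identity and submultiplicativity bound \<open>(cnorm B x)\<^sup>2\<close> by
  \<open>cnorm B (adj B x) * cnorm B x\<close>. Cancelling a factor gives one inequality, and
  exchanging \<open>x\<close> with its adjoint gives the other.\<close>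

lemma cnorm_adj [simp]:
  assumes "x \<in> carrier B" shows "cnorm B (adj B x) = cnorm B x"
proof -
  have *: "cnorm B x \<le> cnorm B (adj B x)" if x: "x \<in> carrier B" for x
  proof (cases "cnorm B x = 0")
    case False
    have "(cnorm B x)\<^sup>2 \<le> cnorm B (adj B x) * cnorm B x"
      using cstar_identity[of x] cnorm_mult[of "adj B x" x] x adj_closed by simp
    then show ?thesis
      using False cnorm_nonneg[of x] x by (simp add: power2_eq_square)
  qed (simp add: cnorm_nonneg adj_closed x)
  show ?thesis
    using *[OF assms] *[OF adj_closed[OF assms]] assms by (simp add: adj_adj)
qed

text \<open>By the C*-identity the norm of the unit equals its own square. It is 0 in the zero
  algebra, which is allowed, hence only an inequality.\<close>

lemma cnorm_one_le: "cnorm B \<one> \<le> 1"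
proof -
  have "cnorm B \<one> = (cnorm B \<one>)\<^sup>2"
    using cstar_identity[of \<one>] by simp
  then have "cnorm B \<one> = 0 \<or> cnorm B \<one> = 1"
    by (auto simp: power2_eq_square)
  then show ?thesis by auto
qed

lemma cnorm_isometry_le:
  assumes "w \<in> carrier B" "adj B w \<otimes> w = \<one>" shows "cnorm B w \<le> 1"
  using cstar_identity[OF assms(1)] assms cnorm_one_le cnorm_nonneg[OF assms(1)]
  by (simp add: abs_square_le_1)

text \<open>Applied to the adjoint and to multiplication by \<open>a\<close> to obtain a complete
  domain for a fixed point argument, and to pairs of *-homomorphisms in
  \<open>star_hom_eq_on_generators\<close>.\<close>

lemma closedin_equalizer:
  assumes "unital_cstar_algebra D" and K: "K \<ge> 0"
    and f: "\<And>x. x \<in> carrier B \<Longrightarrow> f x \<in> carrier D"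
      "\<And>x y. x \<in> carrier B \<Longrightarrow> y \<in> carrier B \<Longrightarrow> cdist D (f x) (f y) \<le> K * cdist B x y"
    and g: "\<And>x. x \<in> carrier B \<Longrightarrow> g x \<in> carrier D"
      "\<And>x y. x \<in> carrier B \<Longrightarrow> y \<in> carrier B \<Longrightarrow> cdist D (g x) (g y) \<le> K * cdist B x y"
  shows "closedin (norm_topology B) {x \<in> carrier B. f x = g x}"
  unfolding Met.closedin_metric
proof (intro conjI allI impI)
  interpret D: Metric_space "carrier D" "cdist D"
    by (rule unital_cstar_algebra.Metric_space_cdist) fact
  fix x assume "x \<in> carrier B - {x \<in> carrier B. f x = g x}"
  then have x: "x \<in> carrier B" and ne: "f x \<noteq> g x" by auto
  \<comment> \<open>Within distance \<open>r\<close> each image moves by at most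
    \<open>K * r\<close>, and \<open>2 * K * r\<close> stays below the gap at \<open>x\<close>; the
    summand 1 also covers \<open>K = 0\<close>.\<close>
  define r where "r = cdist D (f x) (g x) / (2 * K + 1)"
  have "cdist D (f x) (g x) > 0"
    using D.mdist_pos_eq f(1) g(1) ne x by simp
  then have "r > 0" using K by (simp add: r_def)
  have "False" if y: "y \<in> carrier B" "f y = g y" "cdist B x y < r" for y
  proof -
    have "cdist D (f x) (g x) \<le> cdist D (f x) (f y) + cdist D (g y) (g x)"
      using D.triangle[of "f x" "f y" "g x"] f(1) g(1) x y by simp
    also have "\<dots> \<le> K * cdist B x y + K * cdist B x y"
      using f(2)[of x y] g(2)[of y x] x y Met.commute by (intro add_mono) auto
    also have "\<dots> = 2 * K * cdist B x y" by simp
    also have "\<dots> \<le> 2 * K * r"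
      using y K by (intro mult_left_mono) auto
    also have "\<dots> < (2 * K + 1) * r"
      using \<open>r > 0\<close> by simp
    also have "\<dots> = cdist D (f x) (g x)"
      using K by (simp add: r_def)
    finally show False by simp
  qed
  then show "\<exists>r>0. disjnt {x \<in> carrier B. f x = g x} (Met.mball x r)"
    using \<open>r > 0\<close> unfolding disjnt_iff by force
qed auto

lemma add_minus_add_cancel_left:
  "x \<in> carrier B \<Longrightarrow> y \<in> carrier B \<Longrightarrow> z \<in> carrier B \<Longrightarrow> (x \<oplus> y) \<ominus> (x \<oplus> z) = y \<ominus> z"
  using M.a_lcomm[of y "\<ominus> x" "\<ominus> z"]
  by (simp add: M.minus_eq M.minus_add M.a_assoc M.r_neg1 M.r_neg2)

text \<open>Insert the mixed term \<open>u \<otimes> y\<close>. Only \<open>u\<close> and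
  \<open>y\<close> enter through their own norms, so an application can choose which factors it has
  to control.\<close>

lemma cnorm_mult_diff_le:
  assumes "u \<in> carrier B" "v \<in> carrier B" "x \<in> carrier B" "y \<in> carrier B"
  shows "cnorm B (u \<otimes> x \<ominus> v \<otimes> y) \<le> cnorm B u * cnorm B (x \<ominus> y) + cnorm B (u \<ominus> v) * cnorm B y"
proof -
  have "u \<otimes> (x \<ominus> y) \<oplus> (u \<ominus> v) \<otimes> y = u \<otimes> x \<ominus> v \<otimes> y"
    using assms
    by (simp add: M.minus_eq M.r_distr M.l_distr M.r_minus M.l_minus M.a_assoc M.r_neg1)
  then have "cnorm B (u \<otimes> x \<ominus> v \<otimes> y) \<le> cnorm B (u \<otimes> (x \<ominus> y)) + cnorm B ((u \<ominus> v) \<otimes> y)"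
    using assms cnorm_triangle[of "u \<otimes> (x \<ominus> y)" "(u \<ominus> v) \<otimes> y"] by simp
  also have "\<dots> \<le> cnorm B u * cnorm B (x \<ominus> y) + cnorm B (u \<ominus> v) * cnorm B y"
    using assms by (intro add_mono cnorm_mult) auto
  finally show ?thesis .
qed

text \<open>
  Writing \<open>b = 1 - y\<close>, the equation \<open>b\<^sup>2 = 1 - a\<^sup>2\<close> becomes the fixed point equation
  \<open>y = (a\<^sup>2 + y\<^sup>2) / 2\<close>, whose right-hand side is a contraction of the ball of radius \<open>\<parallel>a\<parallel> < 1\<close>.
\<close>

lemma sqrt_one_minus_square:
  assumes a: "a \<in> carrier B" "adj B a = a" "cnorm B a < 1"
  obtains b where "b \<in> carrier B" "adj B b = b" "a \<otimes> b = b \<otimes> a" "a \<otimes> a \<oplus> b \<otimes> b = \<one>"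
proof -
  define x where "x = a \<otimes> a"
  define r where "r = cnorm B a"
  have r: "0 \<le> r" "r < 1" using a by (auto simp: r_def cnorm_nonneg)
  have x: "x \<in> carrier B" "adj B x = x" "a \<otimes> x = x \<otimes> a"
    using a by (simp_all add: x_def adj_mult M.m_assoc)
  have xr: "cnorm B x \<le> r"
  proof -
    have "cnorm B x \<le> r * r" using a cnorm_mult by (simp add: x_def r_def)
    also have "\<dots> \<le> r * 1" using r by (intro mult_left_mono) auto
    finally show ?thesis by simp
  qed
  define T where "T y = (1/2) \<odot> (x \<oplus> y \<otimes> y)" for y
  \<comment> \<open>Self-adjointness and commutation with \<open>a\<close> are closed conditions
    preserved by \<open>T\<close>; building them into the domain passes them on to the fixed
    point.\<close>
  define E where "E = Met.mcball \<zero> r \<inter> {y \<in> carrier B. adj B y = y} \<inter> {y \<in> carrier B. a \<otimes> y = y \<otimes> a}"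
  have inE: "y \<in> E \<longleftrightarrow> y \<in> carrier B \<and> cnorm B y \<le> r \<and> adj B y = y \<and> a \<otimes> y = y \<otimes> a" for y
    by (auto simp: E_def cdist_def M.minus_eq)
  have "closedin Met.mtopology {y \<in> carrier B. adj B y = y}"
    by (rule closedin_equalizer[where K = 1, OF unital_cstar_algebra_axioms])
      (auto simp: adj_closed cdist_def simp flip: adj_diff)
  moreover have "closedin Met.mtopology {y \<in> carrier B. a \<otimes> y = y \<otimes> a}"
  proof (rule closedin_equalizer[where K = "cnorm B a", OF unital_cstar_algebra_axioms])
    fix y z assume yz: "y \<in> carrier B" "z \<in> carrier B"
    have "a \<otimes> y \<ominus> a \<otimes> z = a \<otimes> (y \<ominus> z)" "y \<otimes> a \<ominus> z \<otimes> a = (y \<ominus> z) \<otimes> a"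
      using yz a by (simp_all add: M.minus_eq M.r_distr M.l_distr M.r_minus M.l_minus)
    then show "cdist B (a \<otimes> y) (a \<otimes> z) \<le> cnorm B a * cdist B y z"
      "cdist B (y \<otimes> a) (z \<otimes> a) \<le> cnorm B a * cdist B y z"
      using yz a cnorm_mult[of a "y \<ominus> z"] cnorm_mult[of "y \<ominus> z" a]
      by (simp_all add: cdist_def mult.commute)
  qed (use a in \<open>auto simp: cnorm_nonneg\<close>)
  ultimately have closed: "closedin Met.mtopology E"
    unfolding E_def by (intro closedin_Int Met.closedin_mcball)
  interpret Sub: Submetric "carrier B" "cdist B" E
    by unfold_locales (auto simp: inE)
  have "Sub.sub.mcomplete"
    using Sub.closedin_eq_mcomplete closed complete by blast
  moreover have "\<zero> \<in> E"
    using a r by (auto simp: inE) (metis M.zero_closed adj_closed adj_minus M.minus_zero adj_add M.l_zero M.r_zero M.add.l_cancel_one)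
  \<comment> \<open>Both \<open>x\<close> and \<open>y \<otimes> y\<close> have norm at most
    \<open>r\<close>, because \<open>r * r \<le> r\<close>, and the factor 1/2 balances the
    sum.\<close>
  moreover have "T y \<in> E" if "y \<in> E" for y
  proof -
    have y: "y \<in> carrier B" "cnorm B y \<le> r" "adj B y = y" "a \<otimes> y = y \<otimes> a"
      using that by (auto simp: inE)
    have "cnorm B (y \<otimes> y) \<le> r * r"
      using cnorm_mult[OF y(1) y(1)] y(2) mult_mono[OF y(2) y(2)] r cnorm_nonneg[OF y(1)] by linarith
    also have "\<dots> \<le> r * 1" using r by (intro mult_left_mono) auto
    finally have "cnorm B (x \<oplus> y \<otimes> y) \<le> 2 * r"
      using cnorm_triangle[of x "y \<otimes> y"] x xr y by simp
    then have "cnorm B (T y) \<le> r"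
      using x y by (simp add: T_def cnorm_smult)
    moreover have "adj B (T y) = T y"
      using x y by (simp add: T_def adj_smult adj_add adj_mult)
    moreover have "a \<otimes> (y \<otimes> y) = y \<otimes> y \<otimes> a"
      using a y by (metis M.m_assoc)
    then have "a \<otimes> T y = T y \<otimes> a"
      using a x y by (simp add: T_def smult_mult_right smult_mult_left M.r_distr M.l_distr)
    ultimately show ?thesis
      using x y by (simp add: inE T_def)
  qed
  \<comment> \<open>The difference of squares costs a factor \<open>2 * r\<close>, which the 1/2 in
    \<open>T\<close> turns into the contraction constant \<open>r\<close>.\<close>
  moreover have "cdist B (T y) (T z) \<le> r * cdist B y z" if "y \<in> E" "z \<in> E" for y z
  proof -
    have yz: "y \<in> carrier B" "cnorm B y \<le> r" "z \<in> carrier B" "cnorm B z \<le> r"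
      using that by (auto simp: inE)
    have "cnorm B (y \<otimes> y \<ominus> z \<otimes> z) \<le> cnorm B y * cnorm B (y \<ominus> z) + cnorm B (y \<ominus> z) * cnorm B z"
      using yz by (intro cnorm_mult_diff_le)
    also have "\<dots> \<le> r * cnorm B (y \<ominus> z) + cnorm B (y \<ominus> z) * r"
      using yz by (intro add_mono mult_left_mono mult_right_mono cnorm_nonneg) auto
    finally have "cnorm B (y \<otimes> y \<ominus> z \<otimes> z) \<le> 2 * (r * cnorm B (y \<ominus> z))" by simp
    moreover have "T y \<ominus> T z = (1/2) \<odot> (y \<otimes> y \<ominus> z \<otimes> z)"
      using yz x by (simp add: T_def add_minus_add_cancel_left flip: smult_diff_right)
    ultimately show ?thesis
      using yz x by (simp add: cdist_def cnorm_smult T_def)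
  qed
  ultimately obtain y where "y \<in> E" and fix_y: "T y = y"
    using Sub.sub.contraction_has_fixpoint[of T r] r by blast
  then have y: "y \<in> carrier B" "adj B y = y" "a \<otimes> y = y \<otimes> a"
    by (auto simp: inE)
  have "x \<oplus> y \<otimes> y = 2 \<odot> T y"
    using x y by (simp add: T_def smult_smult)
  also have "\<dots> = y \<oplus> y"
    using fix_y y smult_add_left[of y 1 1] by simp
  finally have xy: "x \<oplus> y \<otimes> y = y \<oplus> y" .
  show thesis
  proof
    show "\<one> \<ominus> y \<in> carrier B" "adj B (\<one> \<ominus> y) = \<one> \<ominus> y" "a \<otimes> (\<one> \<ominus> y) = (\<one> \<ominus> y) \<otimes> a"
      using y a by (simp_all add: adj_add adj_minus M.minus_eq M.r_distr M.l_distr M.r_minus M.l_minus)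
    \<comment> \<open>Expanding the square leaves the term -2y, which cancels against the fixed
      point equation \<open>xy\<close>.\<close>
    have "x \<oplus> (\<one> \<ominus> y) \<otimes> (\<one> \<ominus> y) = (x \<oplus> y \<otimes> y) \<oplus> (\<one> \<ominus> (y \<oplus> y))"
      using x y by (simp add: M.minus_eq M.r_distr M.l_distr M.r_minus M.l_minus M.minus_add M.a_ac)
    also have "\<dots> = \<one>"
      using y by (simp add: xy M.minus_eq M.a_ac M.r_neg1 M.r_neg2 M.minus_add M.r_neg)
    finally show "a \<otimes> a \<oplus> (\<one> \<ominus> y) \<otimes> (\<one> \<ominus> y) = \<one>"
      by (simp add: x_def)
  qed
qed

end

section \<open>Entire functions and Fourier coefficients\<close>

text \<open>The identity theorem applies because the real line accumulates at 0. It carries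
  periodicity and the group law of the flow from real to complex time.\<close>

lemma entire_eq_on_reals:
  fixes F G :: "complex \<Rightarrow> complex"
  assumes "F holomorphic_on UNIV" "G holomorphic_on UNIV"
    and "\<And>t::real. F (of_real t) = G (of_real t)"
  shows "F z = G z"
proof -
  have "(0::complex) islimpt \<real>"
    unfolding islimpt_approachable
  proof (intro allI impI)
    fix e :: real assume "e > 0"
    then show "\<exists>x'\<in>\<real>. x' \<noteq> 0 \<and> dist x' (0::complex) < e"
      by (intro bexI[of _ "of_real (e / 2)"]) auto
  qed
  moreover have "F w - G w = 0" if "w \<in> \<real>" for w
    using that assms(3) by (auto elim!: Reals_cases)
  ultimately have "F z - G z = 0"
    using analytic_continuation[of "\<lambda>w. F w - G w" UNIV "\<real>" 0 z] assms(1,2)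
    by (auto intro!: holomorphic_intros)
  then show ?thesis by simp
qed

lemma holomorphic_shift:
  fixes F :: "complex \<Rightarrow> complex"
  assumes "F holomorphic_on UNIV" shows "(\<lambda>z. F (z + w)) holomorphic_on UNIV"
proof -
  have "F \<circ> (\<lambda>z. z + w) holomorphic_on UNIV"
    by (rule holomorphic_on_compose_gen[OF _ assms]) (auto intro!: holomorphic_intros)
  then show ?thesis by (simp add: o_def)
qed

text \<open>The function \<open>G\<close> of the proof is entire with period 2 pi, so its integral
  over a horizontal segment of length 2 pi does not depend on the height. A primitive
  \<open>Q\<close> shows this: its increment over a period has derivative 0. The factor
  \<open>exp (- \<beta>)\<close> compensates for the exponential in \<open>G\<close> being evaluated
  at the shifted point.\<close>

lemma fourier_coefficient_imaginary_shift:
  fixes F :: "complex \<Rightarrow> complex" and \<beta> :: real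
  assumes hol: "F holomorphic_on UNIV"
    and period: "\<And>t::real. F (of_real (t + 2 * pi)) = F (of_real t)"
  obtains I where
    "((\<lambda>t. exp (- (\<i> * of_real t)) * F (of_real t)) has_integral I) {0..2 * pi}"
    "((\<lambda>t. exp (- (\<i> * of_real t)) * F (of_real t + \<i> * of_real \<beta>)) has_integral
      of_real (exp (- \<beta>)) * I) {0..2 * pi}"
proof -
  define G where "G z = exp (- (\<i> * z)) * F z" for z
  have holG: "G holomorphic_on UNIV"
    unfolding G_def by (intro holomorphic_intros hol)
  then obtain Q where Q: "\<And>z. (Q has_field_derivative G z) (at z)"
    using holomorphic_convex_primitive'[of UNIV G] by auto
  \<comment> \<open>Periodicity is assumed at real arguments and extends by the identity
    theorem.\<close>
  have period_F: "F (z + 2 * pi) = F z" for z :: complex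
  proof (rule entire_eq_on_reals[of "\<lambda>z::complex. F (z + 2 * pi)" F])
    show "(\<lambda>z::complex. F (z + 2 * pi)) holomorphic_on UNIV"
      by (rule holomorphic_shift[OF hol])
    show "F (complex_of_real t + 2 * pi) = F (of_real t)" for t
      using period[of t] by simp
  qed (rule hol)
  have "exp (- (\<i> * (z + 2 * pi))) = exp (- (\<i> * z))" for z :: complex
    using exp_plus_2pin[of "- (\<i> * z)" "-1"] by (simp add: algebra_simps)
  then have period_G: "G (z + 2 * pi) = G z" for z :: complex
    using period_F[of z] by (simp add: G_def)
  have "((\<lambda>z::complex. Q (z + 2 * pi) - Q z) has_field_derivative 0) (at z within UNIV)" for z :: complex
  proof -
    have "((\<lambda>z::complex. Q (z + 2 * pi)) has_field_derivative G (z + 2 * pi) * 1) (at z)"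
      by (rule DERIV_chain2[OF Q]) (auto intro!: derivative_eq_intros)
    from DERIV_diff[OF this Q[of z]] show ?thesis
      using period_G[of z] by simp
  qed
  then obtain c where c: "\<And>z::complex. Q (z + 2 * pi) - Q z = c"
    using has_field_derivative_zero_constant[of UNIV "\<lambda>z::complex. Q (z + 2 * pi) - Q z"] by auto
  have int: "((\<lambda>t. G (of_real t + w)) has_integral c) {0..2 * pi}" for w
  proof -
    have "((\<lambda>z. Q (z + w)) has_field_derivative G (z + w) * 1) (at z)" for z
      by (rule DERIV_chain2[OF Q]) (auto intro!: derivative_eq_intros)
    then have "((\<lambda>t. Q (of_real t + w)) has_vector_derivative G (of_real t + w))
      (at t within {0..2 * pi})" for t :: real
      using has_vector_derivative_real_field[of "\<lambda>z. Q (z + w)" "G (of_real t + w)" t] by simp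
    then have "((\<lambda>t. G (of_real t + w)) has_integral Q (of_real (2 * pi) + w) - Q (of_real 0 + w)) {0..2 * pi}"
      by (intro fundamental_theorem_of_calculus) auto
    then show ?thesis
      using c[of w] by (simp add: add.commute)
  qed
  show thesis
  proof
    show "((\<lambda>t. exp (- (\<i> * of_real t)) * F (of_real t)) has_integral c) {0..2 * pi}"
      using int[of 0] by (simp add: G_def)
    have "of_real (exp (- \<beta>)) * G (of_real t + \<i> * of_real \<beta>) =
        exp (- (\<i> * of_real t)) * F (of_real t + \<i> * of_real \<beta>)" for t :: real
    proof -
      have "exp (- (\<i> * (of_real t + \<i> * of_real \<beta>))) = exp (- (\<i> * of_real t)) * exp (of_real \<beta>)"
        by (simp add: algebra_simps flip: exp_add)
      moreover have "of_real (exp (- \<beta>)) * exp (of_real \<beta> :: complex) = 1"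
        by (simp add: exp_minus flip: exp_of_real)
      ultimately show ?thesis
        by (simp add: G_def mult_ac)
    qed
    with has_integral_mult_right[OF int[of "\<i> * of_real \<beta>"], of "of_real (exp (- \<beta>))"]
    show "((\<lambda>t. exp (- (\<i> * of_real t)) * F (of_real t + \<i> * of_real \<beta>)) has_integral
      of_real (exp (- \<beta>)) * c) {0..2 * pi}"
      by simp
  qed
qed

section \<open>Contractivity of *-homomorphisms and their uniqueness on generators\<close>

text \<open>Take w = a + ib, where b is a self-adjoint square root of 1 - a^2 commuting with
  \<open>a\<close>. The cross terms then cancel and both products equal
  \<open>a \<otimes> a \<oplus> b \<otimes> b\<close>.\<close>

lemma (in unital_cstar_algebra) self_adjoint_eq_unitary_real_part:
  assumes a: "a \<in> carrier B" "adj B a = a" "cnorm B a < 1"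
  obtains w where "w \<in> carrier B" "adj B w \<otimes> w = \<one>" "w \<otimes> adj B w = \<one>" "a = (1/2) \<odot> (w \<oplus> adj B w)"
proof -
  obtain b where b: "b \<in> carrier B" "adj B b = b" "a \<otimes> b = b \<otimes> a" "a \<otimes> a \<oplus> b \<otimes> b = \<one>"
    using sqrt_one_minus_square[OF a] .
  define c where "c = \<i> \<odot> b"
  have c: "c \<in> carrier B" "adj B c = \<ominus> c" "a \<otimes> c = c \<otimes> a" "\<ominus> (c \<otimes> c) = b \<otimes> b"
    using a b by (simp_all add: c_def adj_smult smult_mult_left smult_mult_right smult_smult
        smult_minus_one[of "\<i> \<odot> b", symmetric] smult_minus_one[of "b \<otimes> b"])
  show thesis
  proof
    show "a \<oplus> c \<in> carrier B" using a c by simp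
    have "adj B (a \<oplus> c) \<otimes> (a \<oplus> c) = a \<otimes> a \<oplus> \<ominus> (c \<otimes> c)"
      "(a \<oplus> c) \<otimes> adj B (a \<oplus> c) = a \<otimes> a \<oplus> \<ominus> (c \<otimes> c)"
      using a(1,2) c(1-3)
      by (simp_all add: adj_add M.l_distr M.r_distr M.l_minus M.r_minus M.minus_add M.a_assoc M.r_neg1 M.r_neg2)
    then show "adj B (a \<oplus> c) \<otimes> (a \<oplus> c) = \<one>" "(a \<oplus> c) \<otimes> adj B (a \<oplus> c) = \<one>"
      using c b by simp_all
    have "(a \<oplus> c) \<oplus> adj B (a \<oplus> c) = 2 \<odot> a"
      using a c smult_add_left[of a 1 1]
      by (simp add: adj_add M.a_ac M.r_neg M.r_neg1 M.r_neg2)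
    then show "a = (1/2) \<odot> ((a \<oplus> c) \<oplus> adj B (a \<oplus> c))"
      using a by (simp add: smult_smult)
  qed
qed

text \<open>
  A self-adjoint \<open>a\<close> with \<open>\<parallel>a\<parallel> < 1\<close> is the real part of a unitary, and unital *-homomorphisms
  preserve unitaries; this avoids spectral theory.
\<close>

lemma star_hom_contractive:
  assumes "unital_cstar_algebra B" "unital_cstar_algebra D"
    and h: "unital_star_hom B D h" and x: "x \<in> carrier B"
  shows "cnorm D (h x) \<le> cnorm B x"
proof -
  interpret B: unital_cstar_algebra B by fact
  interpret D: unital_cstar_algebra D by fact
  have ring_h: "h \<in> ring_hom B D"
    and h_smult: "\<And>c x. x \<in> carrier B \<Longrightarrow> h (c \<odot>\<^bsub>B\<^esub> x) = c \<odot>\<^bsub>D\<^esub> h x"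
    and h_adj: "\<And>x. x \<in> carrier B \<Longrightarrow> h (adj B x) = adj D (h x)"
    using h by (auto simp: unital_star_hom_def)
  note h_simps = ring_hom_closed[OF ring_h] ring_hom_mult[OF ring_h] ring_hom_add[OF ring_h]
    ring_hom_one[OF ring_h] h_smult h_adj
  have unit_ball: "cnorm D (h a) \<le> 1"
    if a: "a \<in> carrier B" "adj B a = a" "cnorm B a < 1" for a
  proof -
    obtain w where w: "w \<in> carrier B" "adj B w \<otimes>\<^bsub>B\<^esub> w = \<one>\<^bsub>B\<^esub>"
        "a = (1/2) \<odot>\<^bsub>B\<^esub> (w \<oplus>\<^bsub>B\<^esub> adj B w)"
      using B.self_adjoint_eq_unitary_real_part[OF a] by metis
    have "adj D (h w) \<otimes>\<^bsub>D\<^esub> h w = \<one>\<^bsub>D\<^esub>"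
      using w B.adj_closed by (metis h_simps)
    then have "cnorm D (h w) \<le> 1"
      using w by (intro D.cnorm_isometry_le) (auto simp: h_simps)
    moreover have "h a = (1/2) \<odot>\<^bsub>D\<^esub> (h w \<oplus>\<^bsub>D\<^esub> adj D (h w))"
      using w(1) B.adj_closed by (simp add: w(3) h_simps)
    ultimately show ?thesis
      using w D.cnorm_triangle[of "h w" "adj D (h w)"]
      by (simp add: h_simps D.cnorm_smult D.adj_closed)
  qed
  \<comment> \<open>Dividing by any \<open>r\<close> above the norm moves \<open>a\<close> into the
    open unit ball, also when the norm is 0.\<close>
  have self_adjoint: "cnorm D (h a) \<le> cnorm B a"
    if a: "a \<in> carrier B" "adj B a = a" for a
  proof (rule dense_ge)
    fix r assume r: "cnorm B a < r"
    then have "r > 0" using B.cnorm_nonneg[OF a(1)] by linarith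
    have "cnorm D (h (complex_of_real (1 / r) \<odot>\<^bsub>B\<^esub> a)) \<le> 1"
      using a r \<open>r > 0\<close> by (intro unit_ball) (auto simp: B.adj_smult B.cnorm_smult norm_divide)
    then show "cnorm D (h a) \<le> r"
      using a \<open>r > 0\<close> by (simp add: h_simps D.cnorm_smult norm_divide field_simps)
  qed
  have "(cnorm D (h x))\<^sup>2 = cnorm D (h (adj B x \<otimes>\<^bsub>B\<^esub> x))"
    using x by (simp add: h_simps B.adj_closed D.cstar_identity)
  also have "\<dots> \<le> cnorm B (adj B x \<otimes>\<^bsub>B\<^esub> x)"
    using x by (intro self_adjoint) (auto simp: B.adj_closed B.adj_mult B.adj_adj)
  also have "\<dots> = (cnorm B x)\<^sup>2"
    using x by (simp add: B.cstar_identity)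
  finally show ?thesis
    using B.cnorm_nonneg[OF x] by (rule power2_le_imp_le)
qed

lemma star_hom_diff:
  assumes "unital_cstar_algebra B" "unital_cstar_algebra D" "unital_star_hom B D h"
    and "x \<in> carrier B" "y \<in> carrier B"
  shows "h (x \<ominus>\<^bsub>B\<^esub> y) = h x \<ominus>\<^bsub>D\<^esub> h y"
proof -
  interpret B: unital_cstar_algebra B by fact
  interpret D: unital_cstar_algebra D by fact
  interpret ring_hom_ring B D h
    using assms by (intro ring_hom_ringI2) (auto simp: unital_star_hom_def B.M.ring_axioms D.M.ring_axioms)
  show ?thesis
    using assms by (simp add: B.M.minus_eq D.M.minus_eq)
qed

text \<open>The equalizer is a *-subalgebra, and it is closed because *-homomorphisms are
  contractive. This gives access to the gauge flow, which is prescribed on generators only.\<close>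

lemma star_hom_eq_on_generators:
  assumes B: "unital_cstar_algebra B" and D: "unital_cstar_algebra D"
    and gen: "cstar_generated_by B G"
    and h: "unital_star_hom B D h" and k: "unital_star_hom B D k"
    and eq: "\<And>x. x \<in> G \<Longrightarrow> h x = k x" and x: "x \<in> carrier B"
  shows "h x = k x"
proof -
  interpret B: unital_cstar_algebra B by fact
  interpret D: unital_cstar_algebra D by fact
  define E where "E = {x \<in> carrier B. h x = k x}"
  interpret h: ring_hom_ring B D h
    using h by (intro ring_hom_ringI2) (auto simp: unital_star_hom_def B.M.ring_axioms D.M.ring_axioms)
  interpret k: ring_hom_ring B D k
    using k by (intro ring_hom_ringI2) (auto simp: unital_star_hom_def B.M.ring_axioms D.M.ring_axioms)
  have "closedin (norm_topology B) E"
    unfolding E_def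
    using star_hom_contractive[OF B D h] star_hom_contractive[OF B D k]
    by (intro B.closedin_equalizer[OF D, of 1])
      (auto simp: cdist_def simp flip: star_hom_diff[OF B D h] star_hom_diff[OF B D k])
  moreover have "submodule E complex_ring B"
    using h k by (intro B.submoduleI) (auto simp: E_def unital_star_hom_def)
  then have "star_subalgebra B E"
    using h k by (auto simp: star_subalgebra_def E_def B.adj_closed unital_star_hom_def)
  moreover have "G \<subseteq> carrier B"
    using gen hull_subset unfolding cstar_generated_by_def by metis
  then have "G \<subseteq> E"
    using eq by (auto simp: E_def)
  ultimately have "carrier B \<subseteq> E"
    using gen hull_minimal[of G E] unfolding cstar_generated_by_def by metis
  with x show ?thesis by (auto simp: E_def)
qed

section \<open>Positive functionals and states\<close>

context unital_cstar_algebra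
begin

lemma positive_functional_zero:
  assumes "positive_functional B \<psi>" shows "\<psi> \<zero> = 0"
  using assms M.zero_closed M.l_zero unfolding positive_functional_def
  by (metis add_cancel_right_right)

lemma positive_functional_diff:
  assumes "positive_functional B \<psi>" "x \<in> carrier B" "y \<in> carrier B"
  shows "\<psi> (x \<ominus> y) = \<psi> x - \<psi> y"
  using assms by (simp add: positive_functional_def M.minus_eq flip: smult_minus_one)

lemma positive_functional_finsum:
  assumes "positive_functional B \<psi>" "finite I" "f \<in> I \<rightarrow> carrier B"
  shows "\<psi> (finsum B f I) = (\<Sum>i\<in>I. \<psi> (f i))"
  using assms(2,3)
proof (induction I rule: finite_induct)
  case (insert i I)
  then show ?case
    using assms(1) M.finsum_closed[of f I] M.finsum_insert[of I i f]
    by (auto simp: positive_functional_def Pi_iff)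
qed (simp add: positive_functional_zero assms)

lemma positive_functional_eq_zero:
  assumes pos: "positive_functional B \<psi>" and one: "\<psi> \<one> = 0" and x: "x \<in> carrier B"
  shows "\<psi> x = 0"
proof -
  have add: "\<And>x y. x \<in> carrier B \<Longrightarrow> y \<in> carrier B \<Longrightarrow> \<psi> (x \<oplus> y) = \<psi> x + \<psi> y"
    and smult: "\<And>c x. x \<in> carrier B \<Longrightarrow> \<psi> (c \<odot> x) = c * \<psi> x"
    and nonneg: "\<And>x. x \<in> carrier B \<Longrightarrow> \<psi> (adj B x \<otimes> x) \<in> \<real>\<^sub>\<ge>\<^sub>0"
    using pos by (auto simp: positive_functional_def)
  \<comment> \<open>Since \<open>\<psi>(1) = 0\<close>, the nonnegative function \<open>c \<mapsto> \<psi>((x + c)* (x + c))\<close> is affine, hence constant.\<close>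
  define q where "q c = cnj c * \<psi> x + c * \<psi> (adj B x)" for c
  have nn: "\<psi> (adj B x \<otimes> x) + q c \<in> \<real>\<^sub>\<ge>\<^sub>0" for c
  proof -
    have "\<psi> (adj B (x \<oplus> c \<odot> \<one>) \<otimes> (x \<oplus> c \<odot> \<one>)) = \<psi> (adj B x \<otimes> x) + q c"
      using x one by (simp add: adj_closed adj_add adj_smult M.l_distr M.r_distr smult_mult_left
          smult_mult_right smult_smult add smult q_def)
    then show ?thesis
      using nonneg[of "x \<oplus> c \<odot> \<one>"] x by simp
  qed
  have "q c = 0" for c
  proof -
    let ?p = "\<psi> (adj B x \<otimes> x)"
    have scale: "q (of_real t * c) = of_real t * q c" for t
      by (simp add: q_def algebra_simps)
    have t: "Im (?p + of_real t * q c) = 0" "Re ?p + t * Re (q c) \<ge> 0" for t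
      using nn[of "of_real t * c"] by (simp_all add: scale complex_nonneg_Reals_iff)
    have "Im (q c) = 0" using t(1)[of 0] t(1)[of 1] by simp
    \<comment> \<open>With nonzero slope, the \<open>t\<close> chosen below gives the affine
      expression the value -1.\<close>
    moreover have "Re (q c) = 0"
    proof (rule ccontr)
      assume "Re (q c) \<noteq> 0"
      then show False
        using t(2)[of "- (Re ?p + 1) / Re (q c)"] by simp
    qed
    ultimately show ?thesis by (simp add: complex_eq_iff)
  qed
  \<comment> \<open>The two choices of \<open>c\<close> make the values at \<open>x\<close> and at
    its adjoint both opposite and equal.\<close>
  from this[of 1] this[of \<i>] have "\<psi> x + \<psi> (adj B x) = 0" "\<psi> (adj B x) = \<psi> x"
    by (simp_all add: q_def algebra_simps)
  then show ?thesis by simp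
qed

text \<open>A state is normalised by its norm. A positive functional that kills the unit vanishes,
  and the supremum would be 0. The final argument cancels the value at the unit.\<close>

lemma state_one_nonzero:
  assumes "state B \<psi>" shows "\<psi> \<one> \<noteq> 0"
proof
  assume "\<psi> \<one> = 0"
  then have "{cmod (\<psi> x) |x. x \<in> carrier B \<and> cnorm B x \<le> 1} = {0}"
    using assms positive_functional_eq_zero[of \<psi>] by (auto simp: state_def intro!: exI[of _ \<zero>])
  then show False
    using assms by (simp add: state_def)
qed

lemma state_bound:
  assumes st: "state B \<psi>" and x: "x \<in> carrier B"
  shows "cmod (\<psi> x) \<le> cnorm B x"
proof (rule dense_ge)
  fix r assume "cnorm B x < r"
  then have r: "r > 0" using cnorm_nonneg[OF x] by linarith
  let ?y = "complex_of_real (1 / r) \<odot> x"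
  have "cnorm B ?y \<le> 1"
    using x r \<open>cnorm B x < r\<close> by (simp add: cnorm_smult norm_divide)
  then have "cmod (\<psi> ?y) \<le> Sup {cmod (\<psi> x) |x. x \<in> carrier B \<and> cnorm B x \<le> 1}"
    using st x by (intro cSup_upper) (auto simp: state_def)
  also have "\<dots> = 1" using st by (simp add: state_def)
  also have "\<psi> ?y = of_real (1 / r) * \<psi> x"
    using st x by (simp add: state_def positive_functional_def)
  finally show "cmod (\<psi> x) \<le> r"
    using r by (simp add: norm_mult norm_divide field_simps)
qed

text \<open>A bounded functional turns norm differentiability into scalar differentiability: if
  \<open>l\<close> is the derivative of \<open>f\<close> at \<open>z\<close>, that of the composite
  is \<open>\<psi> (y \<otimes> l)\<close>.\<close>

lemma state_entire_holomorphic: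
  assumes st: "state B \<psi>" and f: "entire B f" and y: "y \<in> carrier B"
  shows "(\<lambda>z. \<psi> (y \<otimes> f z)) holomorphic_on UNIV"
proof -
  have pos: "positive_functional B \<psi>" using st by (simp add: state_def)
  then have smult: "\<And>c x. x \<in> carrier B \<Longrightarrow> \<psi> (c \<odot> x) = c * \<psi> x"
    by (simp add: positive_functional_def)
  have fB [simp]: "f z \<in> carrier B" for z using f by (auto simp: entire_def)
  have "\<exists>D. ((\<lambda>z. \<psi> (y \<otimes> f z)) has_field_derivative D) (at z)" for z
  proof -
    obtain l where l: "l \<in> carrier B"
      and lim: "((\<lambda>h. cnorm B ((1 / h) \<odot> (f (z + h) \<ominus> f z) \<ominus> l)) \<longlongrightarrow> 0) (at 0)"
      using f by (auto simp: entire_def)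
    have bound: "cmod ((\<psi> (y \<otimes> f (z + h)) - \<psi> (y \<otimes> f z)) / h - \<psi> (y \<otimes> l))
        \<le> cnorm B y * cnorm B ((1 / h) \<odot> (f (z + h) \<ominus> f z) \<ominus> l)" for h
    proof -
      have "y \<otimes> ((1 / h) \<odot> (f (z + h) \<ominus> f z) \<ominus> l) =
          (1 / h) \<odot> (y \<otimes> f (z + h) \<ominus> y \<otimes> f z) \<ominus> y \<otimes> l"
        using y l by (simp add: M.minus_eq M.r_distr M.r_minus smult_mult_right)
      then have "\<psi> (y \<otimes> ((1 / h) \<odot> (f (z + h) \<ominus> f z) \<ominus> l)) =
          (\<psi> (y \<otimes> f (z + h)) - \<psi> (y \<otimes> f z)) / h - \<psi> (y \<otimes> l)"
        using y l by (simp add: positive_functional_diff[OF pos] smult)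
      then have "cmod ((\<psi> (y \<otimes> f (z + h)) - \<psi> (y \<otimes> f z)) / h - \<psi> (y \<otimes> l))
          \<le> cnorm B (y \<otimes> ((1 / h) \<odot> (f (z + h) \<ominus> f z) \<ominus> l))"
        using state_bound[OF st, of "y \<otimes> ((1 / h) \<odot> (f (z + h) \<ominus> f z) \<ominus> l)"] y l by simp
      also have "\<dots> \<le> cnorm B y * cnorm B ((1 / h) \<odot> (f (z + h) \<ominus> f z) \<ominus> l)"
        using y l by (intro cnorm_mult) auto
      finally show ?thesis .
    qed
    have "((\<lambda>h. (\<psi> (y \<otimes> f (z + h)) - \<psi> (y \<otimes> f z)) / h - \<psi> (y \<otimes> l)) \<longlongrightarrow> 0) (at 0)"
      by (rule Lim_null_comparison[OF always_eventually[OF allI[OF bound]]])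
        (use tendsto_mult_right_zero[OF lim] in simp)
    then show ?thesis
      unfolding DERIV_def LIM_zero_iff by blast
  qed
  then show ?thesis
    by (auto simp: holomorphic_on_def field_differentiable_def)
qed

end

section \<open>The KMS condition at eigenvectors of the flow\<close>

lemma has_integral_const_dist_le:
  fixes f :: "real \<Rightarrow> complex"
  assumes "(f has_integral I) {a..b}" "a \<le> b"
    and "\<And>t. t \<in> {a..b} \<Longrightarrow> cmod (f t - c) \<le> e"
  shows "cmod (I - of_real (b - a) * c) \<le> e * (b - a)"
proof -
  have "((\<lambda>t. f t - c) has_integral I - (b - a) *\<^sub>R c) {a..b}"
    using has_integral_diff[OF assms(1) has_integral_const_real[of c a b]] assms(2) by simp
  moreover have "e \<ge> 0"
    using assms(2) assms(3)[of a] norm_ge_zero[of "f a - c"] by (simp del: norm_ge_zero)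
  ultimately have "cmod (I - (b - a) *\<^sub>R c) \<le> e * measure lborel {a..b}"
    using assms(3) by (intro has_integral_bound_real[where f = "\<lambda>t. f t - c"]) auto
  then show ?thesis
    using assms(2) by (simp add: scaleR_conv_of_real)
qed

text \<open>For \<open>x = v\<close> and \<open>y = w\<close> the integrands in
  \<open>integrals\<close> are constant in \<open>t\<close>, since the factor
  \<open>exp (- (\<i> * of_real t))\<close> cancels the eigenvalue. Elements of \<open>X\<close>
  near \<open>v\<close> and \<open>w\<close> give integrands uniformly near these constants.\<close>

lemma (in unital_cstar_algebra) kms_eigenvector:
  assumes kms: "kms_state B \<sigma> \<beta> \<psi>"
    and hom: "\<And>t. unital_star_hom B B (\<sigma> t)"
    and flow: "\<And>s t x. x \<in> carrier B \<Longrightarrow> \<sigma> s (\<sigma> t x) = \<sigma> (s + t) x"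
    and period: "\<And>t x. x \<in> carrier B \<Longrightarrow> \<sigma> (t + 2 * pi) x = \<sigma> t x"
    and v: "v \<in> carrier B" and eig: "\<And>t. \<sigma> t v = exp (\<i> * of_real t) \<odot> v"
    and w: "w \<in> carrier B"
  shows "\<psi> (v \<otimes> w) = of_real (exp (- \<beta>)) * \<psi> (w \<otimes> v)"
proof -
  interpret Met: Metric_space "carrier B" "cdist B"
    by (rule Metric_space_cdist)
  from kms obtain X where st: "state B \<psi>" and X: "star_subalgebra B X"
    and X_analytic: "X \<subseteq> analytic_elements B \<sigma>" and X_inv: "\<And>t x. x \<in> X \<Longrightarrow> \<sigma> t x \<in> X"
    and X_dense: "norm_topology B closure_of X = carrier B"
    and X_kms: "\<And>x y. x \<in> X \<Longrightarrow> y \<in> X \<Longrightarrow>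
      \<psi> (x \<otimes> y) = \<psi> (y \<otimes> complex_flow B \<sigma> (\<i> * complex_of_real \<beta>) x)"
    unfolding kms_state_def by blast
  have XB: "x \<in> carrier B" if "x \<in> X" for x
    using X_analytic that by (auto simp: analytic_elements_def)
  have \<sigma>B [simp]: "\<sigma> t x \<in> carrier B" if "x \<in> carrier B" for t x
    using hom[of t] that by (auto simp: unital_star_hom_def ring_hom_closed)
  have pos: "positive_functional B \<psi>" using st by (simp add: state_def)
  then have smult: "\<And>c x. x \<in> carrier B \<Longrightarrow> \<psi> (c \<odot> x) = c * \<psi> x"
    by (simp add: positive_functional_def)
  have \<sigma>_diff: "cnorm B (\<sigma> t x \<ominus> \<sigma> t y) \<le> cnorm B (x \<ominus> y)"
    if "x \<in> carrier B" "y \<in> carrier B" for t x y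
    using star_hom_contractive[OF unital_cstar_algebra_axioms unital_cstar_algebra_axioms hom, of "x \<ominus> y" t]
      star_hom_diff[OF unital_cstar_algebra_axioms unital_cstar_algebra_axioms hom, of x y t] that
    by simp
  have \<psi>_mult_diff: "cmod (\<psi> (a \<otimes> b) - \<psi> (c \<otimes> e)) \<le>
      cnorm B a * cnorm B (b \<ominus> e) + cnorm B (a \<ominus> c) * cnorm B e"
    if "a \<in> carrier B" "b \<in> carrier B" "c \<in> carrier B" "e \<in> carrier B" for a b c e
    using state_bound[OF st, of "a \<otimes> b \<ominus> c \<otimes> e"] cnorm_mult_diff_le[of a c b e] that
    by (simp add: positive_functional_diff[OF pos])
  have approx: "\<exists>x\<in>X. cnorm B (u \<ominus> x) < e" if "u \<in> carrier B" "e > 0" for u e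
  proof -
    have "u \<in> norm_topology B closure_of X" using X_dense that by simp
    then obtain x where "x \<in> X" "x \<in> Met.mball u e"
      using \<open>e > 0\<close> unfolding Met.metric_closure_of by blast
    then show ?thesis by (auto simp: cdist_def)
  qed
  have dist_sym: "cnorm B (x \<ominus> y) = cnorm B (y \<ominus> x)" if "x \<in> carrier B" "y \<in> carrier B" for x y
    using Met.commute[of x y] that by (simp add: cdist_def)
  have twist: "exp (- (\<i> * of_real t)) * exp (\<i> * of_real t) = (1::complex)" for t
    by (simp flip: exp_add)

  have integrals: "\<exists>I. ((\<lambda>t. exp (- (\<i> * of_real t)) * \<psi> (y \<otimes> \<sigma> t x)) has_integral I) {0..2 * pi} \<and>
      ((\<lambda>t. exp (- (\<i> * of_real t)) * \<psi> (\<sigma> t x \<otimes> y)) has_integral of_real (exp (- \<beta>)) * I) {0..2 * pi}"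
    if x: "x \<in> X" and y: "y \<in> X" for x y
  proof -
    \<comment> \<open>This is the same choice as in \<open>complex_flow\<close>, so
      \<open>X_kms\<close> speaks about \<open>ext\<close>.\<close>
    define ext where "ext x = (SOME f. entire_extension B \<sigma> x f)" for x
    have ext: "entire_extension B \<sigma> x (ext x)" if "x \<in> X" for x
      using X_analytic that someI_ex[of "entire_extension B \<sigma> x"]
      by (auto simp: analytic_elements_def ext_def)
    have ext_entire: "entire B (ext x)" and ext_real: "ext x (of_real t) = \<sigma> t x" if "x \<in> X" for x t
      using ext[OF that] by (auto simp: entire_extension_def)
    have hol: "(\<lambda>z. \<psi> (y \<otimes> ext x z)) holomorphic_on UNIV" if "x \<in> X" for x
      using state_entire_holomorphic[OF st ext_entire[OF that] XB[OF y]] .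
    have kms_ext: "\<psi> (\<sigma> t x \<otimes> y) = \<psi> (y \<otimes> ext x (of_real t + \<i> * of_real \<beta>))" for t
    proof -
      \<comment> \<open>The extensions for \<open>\<sigma> t x\<close> and for \<open>x\<close> are
        chosen independently. They are compared after applying the functional, where both sides are
        scalar entire functions that agree at real arguments.\<close>
      have "\<psi> (y \<otimes> ext (\<sigma> t x) z) = \<psi> (y \<otimes> ext x (z + of_real t))" for z
      proof (rule entire_eq_on_reals[where F = "\<lambda>z. \<psi> (y \<otimes> ext (\<sigma> t x) z)" and G = "\<lambda>z. \<psi> (y \<otimes> ext x (z + of_real t))"])
        show "(\<lambda>z. \<psi> (y \<otimes> ext (\<sigma> t x) z)) holomorphic_on UNIV"
          "(\<lambda>z. \<psi> (y \<otimes> ext x (z + of_real t))) holomorphic_on UNIV"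
          using hol[OF X_inv[OF x]] holomorphic_shift[OF hol[OF x]] by auto
        fix s :: real
        show "\<psi> (y \<otimes> ext (\<sigma> t x) (of_real s)) = \<psi> (y \<otimes> ext x (of_real s + of_real t))"
          using ext_real[OF X_inv[OF x], of t s] ext_real[OF x, of "s + t"] flow[OF XB[OF x], of s t]
          by simp
      qed
      then show ?thesis
        using X_kms[OF X_inv[OF x] y, of t] by (simp add: complex_flow_def ext_def add.commute)
    qed
    have real_ext: "\<psi> (y \<otimes> \<sigma> t x) = \<psi> (y \<otimes> ext x (of_real t))" for t
      using ext_real[OF x] by simp
    have period_ext: "\<psi> (y \<otimes> ext x (of_real (t + 2 * pi))) = \<psi> (y \<otimes> ext x (of_real t))" for t
      using ext_real[OF x] period[OF XB[OF x]] by (simp del: of_real_add)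
    show ?thesis
      unfolding kms_ext real_ext
      by (rule fourier_coefficient_imaginary_shift[OF hol[OF x] period_ext, of \<beta>]) blast
  qed

  \<comment> \<open>The summand 1 comes from \<open>norm_y\<close>, where \<open>e \<le> 1\<close>
    bounds the norm of the approximant \<open>y\<close>.\<close>
  define K where "K = cnorm B v + cnorm B w + 1"
  let ?b = "complex_of_real (exp (- \<beta>))"
  have K: "K > 0" using v w by (simp add: K_def cnorm_nonneg add_nonneg_pos)
  have est: "cmod (\<psi> (v \<otimes> w) - ?b * \<psi> (w \<otimes> v)) \<le> e * (K * (1 + exp (- \<beta>)))"
    if e: "0 < e" "e \<le> 1" for e
  proof -
    obtain x where x: "x \<in> X" "cnorm B (v \<ominus> x) < e" using approx[OF v e(1)] by blast
    obtain y where y: "y \<in> X" "cnorm B (w \<ominus> y) < e" using approx[OF w e(1)] by blast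
    note xB = XB[OF x(1)] and yB = XB[OF y(1)]
    obtain I where I: "((\<lambda>t. exp (- (\<i> * of_real t)) * \<psi> (y \<otimes> \<sigma> t x)) has_integral I) {0..2 * pi}"
      "((\<lambda>t. exp (- (\<i> * of_real t)) * \<psi> (\<sigma> t x \<otimes> y)) has_integral ?b * I) {0..2 * pi}"
      using integrals[OF x(1) y(1)] by blast
    have norm_y: "cnorm B y \<le> cnorm B w + 1"
    proof -
      have "y = w \<ominus> (w \<ominus> y)"
        using w yB by (simp add: M.minus_eq M.minus_add M.r_neg2)
      then have "cnorm B y \<le> cnorm B w + cnorm B (w \<ominus> y)"
        using cnorm_diff[of w "w \<ominus> y"] w yB by simp
      then show ?thesis using y e by simp
    qed
    have \<sigma>v: "\<sigma> t v \<in> carrier B" "cnorm B (\<sigma> t v) = cnorm B v" for t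
      using v by (simp_all add: eig cnorm_smult)
    have dx: "cnorm B (\<sigma> t x \<ominus> \<sigma> t v) \<le> e" for t
      using \<sigma>_diff[OF xB v, of t] x dist_sym[OF v xB] by simp
    have dy: "cnorm B (y \<ominus> w) \<le> e"
      using y dist_sym[OF w yB] by simp
    have close1: "cmod (exp (- (\<i> * of_real t)) * \<psi> (y \<otimes> \<sigma> t x) - \<psi> (w \<otimes> v)) \<le> e * K" for t
    proof -
      have "exp (- (\<i> * of_real t)) * \<psi> (w \<otimes> \<sigma> t v) = \<psi> (w \<otimes> v)"
        using v w twist by (simp add: eig smult_mult_right smult flip: mult.assoc)
      then have "cmod (exp (- (\<i> * of_real t)) * \<psi> (y \<otimes> \<sigma> t x) - \<psi> (w \<otimes> v)) =
          cmod (exp (- (\<i> * of_real t)) * (\<psi> (y \<otimes> \<sigma> t x) - \<psi> (w \<otimes> \<sigma> t v)))"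
        by (simp add: right_diff_distrib)
      also have "\<dots> = cmod (\<psi> (y \<otimes> \<sigma> t x) - \<psi> (w \<otimes> \<sigma> t v))"
        by (simp add: norm_mult)
      also have "\<dots> \<le> cnorm B y * cnorm B (\<sigma> t x \<ominus> \<sigma> t v) + cnorm B (y \<ominus> w) * cnorm B (\<sigma> t v)"
        using v w xB yB by (intro \<psi>_mult_diff) auto
      also have "\<dots> \<le> (cnorm B w + 1) * e + e * cnorm B v"
        unfolding \<sigma>v using norm_y dx dy v e cnorm_nonneg[OF w]
        by (intro add_mono mult_mono cnorm_nonneg) (auto intro: cnorm_nonneg simp: xB)
      also have "\<dots> = e * K" by (simp add: K_def algebra_simps)
      finally show ?thesis .
    qed
    have close2: "cmod (exp (- (\<i> * of_real t)) * \<psi> (\<sigma> t x \<otimes> y) - \<psi> (v \<otimes> w)) \<le> e * K" for t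
    proof -
      have "exp (- (\<i> * of_real t)) * \<psi> (\<sigma> t v \<otimes> w) = \<psi> (v \<otimes> w)"
        using v w twist by (simp add: eig smult_mult_left smult flip: mult.assoc)
      \<comment> \<open>The difference is reversed so that the norms left over are those of
        \<open>\<sigma> t v\<close> and \<open>y\<close>, which gives the constant \<open>K\<close>
        again.\<close>
      then have "cmod (exp (- (\<i> * of_real t)) * \<psi> (\<sigma> t x \<otimes> y) - \<psi> (v \<otimes> w)) =
          cmod (exp (- (\<i> * of_real t)) * (\<psi> (\<sigma> t v \<otimes> w) - \<psi> (\<sigma> t x \<otimes> y)))"
        by (simp add: right_diff_distrib norm_minus_commute)
      also have "\<dots> = cmod (\<psi> (\<sigma> t v \<otimes> w) - \<psi> (\<sigma> t x \<otimes> y))"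
        by (simp add: norm_mult)
      also have "\<dots> \<le> cnorm B (\<sigma> t v) * cnorm B (w \<ominus> y) + cnorm B (\<sigma> t v \<ominus> \<sigma> t x) * cnorm B y"
        using v w xB yB by (intro \<psi>_mult_diff) auto
      also have "\<dots> \<le> cnorm B v * e + e * (cnorm B w + 1)"
        unfolding \<sigma>v using norm_y dx[of t] y dist_sym[OF \<sigma>B[OF xB] \<sigma>v(1), of t t] v w e cnorm_nonneg[OF w]
        by (intro add_mono mult_mono cnorm_nonneg) (auto intro: cnorm_nonneg simp: xB yB)
      also have "\<dots> = e * K" by (simp add: K_def algebra_simps)
      finally show ?thesis .
    qed
    have "cmod (I - of_real (2 * pi) * \<psi> (w \<otimes> v)) \<le> e * K * (2 * pi)"
      using has_integral_const_dist_le[OF I(1) _ close1] by simp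
    then have "cmod (?b * (I - of_real (2 * pi) * \<psi> (w \<otimes> v))) \<le> exp (- \<beta>) * (e * K * (2 * pi))"
      by (simp add: norm_mult)
    moreover have "cmod (?b * I - of_real (2 * pi) * \<psi> (v \<otimes> w)) \<le> e * K * (2 * pi)"
      using has_integral_const_dist_le[OF I(2) _ close2] by simp
    ultimately have "cmod (?b * (I - of_real (2 * pi) * \<psi> (w \<otimes> v)) - (?b * I - of_real (2 * pi) * \<psi> (v \<otimes> w)))
        \<le> exp (- \<beta>) * (e * K * (2 * pi)) + e * K * (2 * pi)"
      by (rule order_trans[OF norm_triangle_ineq4 add_mono])
    \<comment> \<open>The unknown coefficient \<open>I\<close> cancels.\<close>
    also have "?b * (I - of_real (2 * pi) * \<psi> (w \<otimes> v)) - (?b * I - of_real (2 * pi) * \<psi> (v \<otimes> w)) =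
        of_real (2 * pi) * (\<psi> (v \<otimes> w) - ?b * \<psi> (w \<otimes> v))"
      by (simp add: algebra_simps)
    also have "cmod \<dots> = 2 * pi * cmod (\<psi> (v \<otimes> w) - ?b * \<psi> (w \<otimes> v))"
      by (simp add: norm_mult)
    also have "exp (- \<beta>) * (e * K * (2 * pi)) + e * K * (2 * pi) = 2 * pi * (e * (K * (1 + exp (- \<beta>))))"
      by (simp add: algebra_simps)
    finally show ?thesis by simp
  qed
  have "cmod (\<psi> (v \<otimes> w) - ?b * \<psi> (w \<otimes> v)) \<le> 0"
  proof (rule field_le_epsilon)
    fix \<epsilon> :: real assume "\<epsilon> > 0"
    define L where "L = K * (1 + exp (- \<beta>))"
    have "L > 0" using K by (simp add: L_def add_pos_pos)
    have "cmod (\<psi> (v \<otimes> w) - ?b * \<psi> (w \<otimes> v)) \<le> min 1 (\<epsilon> / L) * L"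
      using est[of "min 1 (\<epsilon> / L)"] \<open>L > 0\<close> \<open>\<epsilon> > 0\<close> by (simp add: L_def)
    also have "\<dots> \<le> \<epsilon> / L * L"
      using \<open>L > 0\<close> by (intro mult_right_mono) auto
    finally show "cmod (\<psi> (v \<otimes> w) - ?b * \<psi> (w \<otimes> v)) \<le> 0 + \<epsilon>"
      using \<open>L > 0\<close> by simp
  qed
  then show ?thesis by simp
qed

section \<open>The gauge flow and the value of the inverse temperature\<close>

theorem proposition3p7:
  fixes A :: "'a cstar" and d :: nat and \<alpha> :: "nat \<Rightarrow> 'a \<Rightarrow> 'a"
    and B :: "'b cstar" and \<iota> :: "'a \<Rightarrow> 'b" and S :: "nat \<Rightarrow> 'b"
    and \<gamma> :: "complex \<Rightarrow> 'b \<Rightarrow> 'b" and \<sigma> :: "real \<Rightarrow> 'b \<Rightarrow> 'b" and \<beta> :: real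
  assumes "injective_unital_cstar_system A d \<alpha>"
    and "cuntz_pimsner_algebra A d \<alpha> B \<iota> S"
    and "gauge_action A d B \<iota> S \<gamma>"
    and "\<And>t. \<sigma> t = \<gamma> (exp (\<i> * complex_of_real t))"
    and "\<beta> \<noteq> ln (real d)"
  shows "\<not> (\<exists>\<psi>. kms_state B \<sigma> \<beta> \<psi>)"
proof
  assume "\<exists>\<psi>. kms_state B \<sigma> \<beta> \<psi>"
  then obtain \<psi> where kms: "kms_state B \<sigma> \<beta> \<psi>" by blast
  interpret CP: cuntz_pimsner_algebra A d \<alpha> B \<iota> S by fact
  have B: "unital_cstar_algebra B" by unfold_locales
  have S [simp]: "S i \<in> carrier B" if "i \<in> {1..d}" for i
    using CP.covariant that by (simp add: covariant_row_unitary_def row_unitary_def)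
  have \<iota> [simp]: "\<iota> a \<in> carrier B" if "a \<in> carrier A" for a
    using CP.covariant that
    by (auto simp: covariant_row_unitary_def unital_star_hom_def ring_hom_closed)
  have \<gamma>: "unital_star_hom B B (\<gamma> z)" "\<And>a. a \<in> carrier A \<Longrightarrow> \<gamma> z (\<iota> a) = \<iota> a"
    "\<And>i. i \<in> {1..d} \<Longrightarrow> \<gamma> z (S i) = z \<odot>\<^bsub>B\<^esub> S i" if "cmod z = 1" for z
    using assms(3) that by (auto simp: gauge_action_def star_automorphism_def)
  have hom: "unital_star_hom B B (\<sigma> t)" for t
    using \<gamma>(1) assms(4) by simp
  have \<sigma>_\<iota>: "\<sigma> t (\<iota> a) = \<iota> a" if "a \<in> carrier A" for t a
    using \<gamma>(2) assms(4) that by simp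
  have \<sigma>_S: "\<sigma> t (S i) = exp (\<i> * of_real t) \<odot>\<^bsub>B\<^esub> S i" if "i \<in> {1..d}" for t i
    using \<gamma>(3) assms(4) that by simp
  \<comment> \<open>The group law is not part of \<open>gauge_action\<close>; both sides are
    *-homomorphisms that agree on the generators.\<close>
  have flow: "\<sigma> s (\<sigma> t x) = \<sigma> (s + t) x" if "x \<in> carrier B" for s t x
  proof (rule star_hom_eq_on_generators[OF B B CP.generated _ hom _ that])
    show "unital_star_hom B B (\<lambda>x. \<sigma> s (\<sigma> t x))"
      using hom[of s] hom[of t] unfolding unital_star_hom_def ring_hom_def
      by (auto simp: Pi_iff CP.B.adj_closed)
    fix u assume "u \<in> \<iota> ` carrier A \<union> S ` {1..d}"
    then show "\<sigma> s (\<sigma> t u) = \<sigma> (s + t) u"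
    proof
      assume "u \<in> S ` {1..d}"
      then obtain i where i: "i \<in> {1..d}" "u = S i" by blast
      have "\<sigma> s (exp (\<i> * of_real t) \<odot>\<^bsub>B\<^esub> S i) = exp (\<i> * of_real t) \<odot>\<^bsub>B\<^esub> \<sigma> s (S i)"
        using hom[of s] i by (simp add: unital_star_hom_def)
      then show ?thesis
        using i by (simp add: \<sigma>_S CP.B.smult_smult distrib_left exp_add mult.commute)
    qed (auto simp: \<sigma>_\<iota>)
  qed
  have period: "\<sigma> (t + 2 * pi) = \<sigma> t" for t
    using exp_plus_2pin[of "\<i> * of_real t" 1] by (simp add: assms(4) algebra_simps)
  have st: "state B \<psi>" and pos: "positive_functional B \<psi>"
    using kms by (auto simp: kms_state_def state_def)
  \<comment> \<open>The range projections of the isometries sum to the unit. The eigenvector lemma,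
    with \<open>v = S i\<close> and \<open>w = adj B (S i)\<close>, turns each into the unit times
    \<open>exp (- \<beta>)\<close> under the state.\<close>
  have "\<psi> (\<one>\<^bsub>B\<^esub>) = (\<Sum>i\<in>{1..d}. \<psi> (S i \<otimes>\<^bsub>B\<^esub> adj B (S i)))"
    using CP.B.positive_functional_finsum[OF pos, of "{1..d}" "\<lambda>i. S i \<otimes>\<^bsub>B\<^esub> adj B (S i)"] CP.covariant
    by (simp add: covariant_row_unitary_def row_unitary_def Pi_iff CP.B.adj_closed)
  also have "\<dots> = (\<Sum>i\<in>{1..d}. of_real (exp (- \<beta>)) * \<psi> (adj B (S i) \<otimes>\<^bsub>B\<^esub> S i))"
    using CP.B.kms_eigenvector[OF kms hom flow] period \<sigma>_S
    by (intro sum.cong) (auto simp: CP.B.adj_closed)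
  also have "\<dots> = (\<Sum>i\<in>{1..d}. of_real (exp (- \<beta>)) * \<psi> (\<one>\<^bsub>B\<^esub>))"
    using CP.covariant by (intro sum.cong) (auto simp: covariant_row_unitary_def row_unitary_def)
  also have "\<dots> = of_real (real d * exp (- \<beta>)) * \<psi> (\<one>\<^bsub>B\<^esub>)"
    by simp
  finally have "complex_of_real (real d * exp (- \<beta>)) = 1"
    using CP.B.state_one_nonzero[OF st] by simp
  then have "real d * exp (- \<beta>) = 1"
    by (simp only: of_real_eq_1_iff)
  then have "real d = exp \<beta>"
    by (simp add: exp_minus field_simps)
  then show False
    using assms(5) by simp
qed

end
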